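(* Let $\Gamma$ be a connected plane trivalent graph. Suppose that $\Gamma$ contains a configuration $C$ which is state-reducible with reducer $C'$, and let $\Gamma'$ be the plane graph obtained from $\Gamma$ by replacing $C$ with $C'$ (so that $\Gamma$ is state-reducible with reducer $\Gamma'$). If $\Gamma'$ is $4$-face colorable, then $\Gamma$ is $4$-face colorable.
   Context: **Plane graphs and ribbon graphs.** Graphs are finite and may have multiple edges. A plane graph $\Gamma$ of a connected planar graph $G(V,E)$ is a CW structure on $S^2$ whose $1$-skeleton is $G$. Removing a small open disk from each $2$-cell gives a ribbon graph: a surface with boundary made of a closed disk for each vertex and a closed ribbon (band) for each edge, with the ends of the ribbons glued to arcs in the boundaries of the vertex disks. The faces of $\Gamma$ correspond to the boundary circles of this ribbon graph. "Trivalent" means every vertex has degree $3$. **State graphs.** Label and order the edges $e_1,\dots,e_{|E|}$. For $\alpha=(\alpha_1,\dots,\alpha_{|E|})\in\{0,1\}^{|E|}$, the state graph $\Gamma_\alpha$ is the ribbon graph obtained from that of $\Gamma$ by replacing, for every $i$ with $\alpha_i=1$, the ribbon of $e_i$ by a ribbon with a half-twist, and leaving the ribbon unchanged when $\alpha_i=0$. Gluing disks (faces) to all boundary circles of $\Gamma_\alpha$ gives a closed, possibly non-orientable, surface, also denoted $\Gamma_\alpha$, with $1$-skeleton $G$. In particular $\Gamma_{(0,\dots,0)}=\Gamma$. **Colorings.** A (proper) $n$-face coloring of $\Gamma_\alpha$ is an assignment of one of $n$ distinct colors to each face (equivalently, to each boundary circle of the ribbon graph) such that the faces on the two sides of each edge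 have different colors. In particular, if the same face lies on both sides of some edge, there is no proper coloring. $\Gamma_\alpha$ is $n$-face colorable if it has an $n$-face coloring. An enhanced state is a pair $(\Gamma_\alpha,c)$ where $c$ is an $n$-face coloring of $\Gamma_\alpha$. **Configurations and reducers.** Let $\Gamma$ be a plane graph of a bridgeless trivalent connected planar graph. A configuration $C$ in $\Gamma$ is a connected set of faces. It is replaced, inside the disk region it occupies, by a smaller configuration $C'$ (a plane trivalent piece of graph attached to the same boundary edges) to get a new plane graph $\Gamma'$ that is also connected and trivalent. The edges crossing the boundary of the region are called spokes, and they are regarded as belonging to the configuration. If the sum of the numbers of vertices and edges of $\Gamma'$ is less than that of $\Gamma$, then $\Gamma'$ (and also $C'$) is called a reducer of $\Gamma$ (of $C$). The edges of $\Gamma$ outside $C$ are identified with the edges of $\Gamma'$ outside $C'$. **State-extendibility and state-reducibility.** An enhanced state $(\Gamma'_\alpha,c')$ of $\Gamma'$, where $c'$ is a $3$-face coloring of $\Gamma'_\alpha$, is state-extendible if there is an enhanced state $(\Gamma_\beta,c)$ of $\Gamma$, where $c$ is a $4$-face coloring of the state graph $\Gamma_\beta$, such that both states are the same outside of their configurations (that is, $\alpha$ and $\beta$ agree on every edge outside the configurations). Suppose that the set of all enhanced states $(\Gamma'_\alpha,c')$ with $c'$ a $3$-face coloring (over all $\alpha$) is nonempty. If every enhanced state in this set is state-extendible to some $(\Gamma_\beta,c)$ with $c$ a $4$-face coloring of some state graph $\Gamma_\beta$ of $\Gamma$, then $C$ (or $\Gamma$) is said to be state-reducible with reducer $C'$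 (respectively $\Gamma'$). *)

theory Defs
  imports "HOL-Combinatorics.Permutations" "HOL-Combinatorics.Orbits"
begin

section \<open>Ribbon graphs\<close>

text \<open>
  A ribbon graph is encoded by a signed rotation system.  Its half-edges are the
  \<open>darts\<close>; \<open>rot\<close> sends a dart to the next one counterclockwise on the boundary of its
  vertex disk, \<open>opp\<close> sends a dart to the other half of its edge, and \<open>twisted\<close> is the
  set of edges whose ribbon carries a half-twist relative to the orientations of the
  two vertex disks.  Loops and multiple edges are possible.
\<close>

record 'a ribbon_graph =
  darts :: "'a set"
  rot :: "'a \<Rightarrow> 'a"
  opp :: "'a \<Rightarrow> 'a"
  twisted :: "'a set set"

definition vertices :: "'a ribbon_graph \<Rightarrow> 'a set set" where
  "vertices R = orbit (rot R) ` darts R"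

definition edges :: "'a ribbon_graph \<Rightarrow> 'a set set" where
  "edges R = (\<lambda>d. {d, opp R d}) ` darts R"

definition ribbon_graph :: "'a ribbon_graph \<Rightarrow> bool" where
  "ribbon_graph R \<longleftrightarrow>
     finite (darts R) \<and> rot R permutes darts R \<and> opp R permutes darts R \<and>
     (\<forall>d\<in>darts R. opp R d \<noteq> d \<and> opp R (opp R d) = d) \<and> twisted R \<subseteq> edges R"

definition trivalent :: "'a ribbon_graph \<Rightarrow> bool" where
  "trivalent R \<longleftrightarrow> (\<forall>v\<in>vertices R. card v = 3)"

text \<open>Connectedness of the spanning subgraph of the 1-skeleton with edge set \<open>E\<close>.
  Every vertex is represented by its darts, also by those whose edge is not in \<open>E\<close>.\<close>

definition connected_via :: "'a ribbon_graph \<Rightarrow> 'a set set \<Rightarrow> bool" where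
  "connected_via R E \<longleftrightarrow>
     (\<forall>x\<in>darts R. \<forall>y\<in>darts R.
        (x, y) \<in> ({(d, rot R d) | d. d \<in> darts R} \<union>
                 {(d, opp R d) | d. d \<in> darts R \<and> {d, opp R d} \<in> E})\<^sup>*)"

definition connected_graph :: "'a ribbon_graph \<Rightarrow> bool" where
  "connected_graph R \<longleftrightarrow> connected_via R (edges R)"

definition bridgeless :: "'a ribbon_graph \<Rightarrow> bool" where
  "bridgeless R \<longleftrightarrow> (\<forall>e\<in>edges R. connected_via R (edges R - {e}))"

text \<open>
  The boundary of the surface is cut into pieces labelled by flags.  Seen from its
  vertex, dart \<open>d\<close> has a left side \<open>(d, True)\<close> and a right side \<open>(d, False)\<close>.  Going
  counterclockwise along the boundary of a vertex disk, the left side of \<open>d\<close> is followed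
  by the right side of \<open>rot R d\<close>.  Along a flat ribbon, the left side of \<open>d\<close> is the right
  side of \<open>opp R d\<close>; along a half-twisted one, it is the left side of \<open>opp R d\<close>.
\<close>

definition flags :: "'a ribbon_graph \<Rightarrow> ('a \<times> bool) set" where
  "flags R = darts R \<times> UNIV"

definition boundary_step :: "'a ribbon_graph \<Rightarrow> (('a \<times> bool) \<times> ('a \<times> bool)) set" where
  "boundary_step R =
     {((d, True), (rot R d, False)) | d. d \<in> darts R} \<union>
     {((d, s), (opp R d, if {d, opp R d} \<in> twisted R then s else \<not> s)) | d s. d \<in> darts R}"

definition boundary_rel :: "'a ribbon_graph \<Rightarrow> (('a \<times> bool) \<times> ('a \<times> bool)) set" where
  "boundary_rel R = (boundary_step R \<union> (boundary_step R)\<inverse>)\<^sup>*"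

text \<open>The boundary circles, that is, the faces of the closed surface.\<close>

definition faces :: "'a ribbon_graph \<Rightarrow> ('a \<times> bool) set set" where
  "faces R = flags R // boundary_rel R"

definition face_of :: "'a ribbon_graph \<Rightarrow> 'a \<times> bool \<Rightarrow> ('a \<times> bool) set" where
  "face_of R x = boundary_rel R `` {x}"

definition face_coloring ::
    "nat \<Rightarrow> 'a ribbon_graph \<Rightarrow> (('a \<times> bool) set \<Rightarrow> nat) \<Rightarrow> bool" where
  "face_coloring n R c \<longleftrightarrow>
     (\<forall>f\<in>faces R. c f < n) \<and>
     (\<forall>d\<in>darts R. c (face_of R (d, True)) \<noteq> c (face_of R (d, False)))"

definition face_colorable :: "nat \<Rightarrow> 'a ribbon_graph \<Rightarrow> bool" where
  "face_colorable n R \<longleftrightarrow> (\<exists>c. face_coloring n R c)"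

text \<open>
  A plane graph is the ribbon graph of a CW structure on the oriented sphere.  There the
  vertex disks carry the orientation of the sphere, so no ribbon is twisted; conversely,
  by the classification of surfaces, the closed connected surface obtained by gluing
  disks to the boundary circles is a sphere iff its Euler characteristic is 2.
\<close>

definition plane_graph :: "'a ribbon_graph \<Rightarrow> bool" where
  "plane_graph G \<longleftrightarrow>
     ribbon_graph G \<and> twisted G = {} \<and> connected_graph G \<and>
     int (card (vertices G)) - int (card (edges G)) + int (card (faces G)) = 2"


section \<open>State graphs\<close>

text \<open>A state \<open>\<alpha> \<in> {0,1}\<^sup>E\<close> is given as the set \<open>A\<close> of edges \<open>e\<close> with \<open>\<alpha> e = 1\<close>.\<close>

definition state_graph :: "'a ribbon_graph \<Rightarrow> 'a set set \<Rightarrow> 'a ribbon_graph" where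
  "state_graph G A = G\<lparr>twisted := A\<rparr>"

definition enhanced_states ::
    "nat \<Rightarrow> 'a ribbon_graph \<Rightarrow> ('a set set \<times> (('a \<times> bool) set \<Rightarrow> nat)) set" where
  "enhanced_states n G = {(A, c). A \<subseteq> edges G \<and> face_coloring n (state_graph G A) c}"


section \<open>Configurations\<close>

text \<open>
  For a set \<open>C\<close> of faces, \<open>face_darts\<close> are the halves of the edges lying on a face in
  \<open>C\<close>, \<open>inner_darts\<close> are all darts at the vertices of these faces, and \<open>outer_darts\<close> are
  the remaining ones.  The boundary of a thin neighbourhood of the union of the closed
  faces in \<open>C\<close> crosses the graph once near the vertex end of each dart in \<open>spokes\<close>; such
  a dart also serves as the name of this crossing point.  An edge running outside the
  region between two vertices of \<open>C\<close> is crossed twice, once for each of its darts.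
\<close>

definition face_darts :: "'a ribbon_graph \<Rightarrow> ('a \<times> bool) set set \<Rightarrow> 'a set" where
  "face_darts G C = {d \<in> darts G. (d, True) \<in> \<Union>C \<or> (d, False) \<in> \<Union>C}"

definition inner_darts :: "'a ribbon_graph \<Rightarrow> ('a \<times> bool) set set \<Rightarrow> 'a set" where
  "inner_darts G C = {d \<in> darts G. orbit (rot G) d \<inter> face_darts G C \<noteq> {}}"

definition outer_darts :: "'a ribbon_graph \<Rightarrow> ('a \<times> bool) set set \<Rightarrow> 'a set" where
  "outer_darts G C = darts G - inner_darts G C"

definition spokes :: "'a ribbon_graph \<Rightarrow> ('a \<times> bool) set set \<Rightarrow> 'a set" where
  "spokes G C = inner_darts G C - face_darts G C"

text \<open>The edges of \<open>G\<close> outside \<open>C\<close>; the edges of the spokes belong to \<open>C\<close>.\<close>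

definition outside_edges :: "'a ribbon_graph \<Rightarrow> ('a \<times> bool) set set \<Rightarrow> 'a set set" where
  "outside_edges G C = {e \<in> edges G. e \<subseteq> outer_darts G C}"

definition connected_faces :: "'a ribbon_graph \<Rightarrow> ('a \<times> bool) set set \<Rightarrow> bool" where
  "connected_faces G C \<longleftrightarrow>
     (\<forall>f\<in>C. \<forall>g\<in>C. (f, g) \<in>
        {(h, k). h \<in> C \<and> k \<in> C \<and> (\<exists>d\<in>darts G. (d, True) \<in> h \<and> (d, False) \<in> k)}\<^sup>*)"

text \<open>The neighbourhood of \<open>C\<close> is a connected subsurface of the sphere, hence a disk iff
  the Euler characteristic of the union of the closed faces in \<open>C\<close> is 1.\<close>

definition disk_region :: "'a ribbon_graph \<Rightarrow> ('a \<times> bool) set set \<Rightarrow> bool" where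
  "disk_region G C \<longleftrightarrow>
     int (card (orbit (rot G) ` face_darts G C)) - int (card ((\<lambda>d. {d, opp G d}) ` face_darts G C))
       + int (card C) = 1"

definition configuration :: "'a ribbon_graph \<Rightarrow> ('a \<times> bool) set set \<Rightarrow> bool" where
  "configuration G C \<longleftrightarrow>
     plane_graph G \<and> trivalent G \<and> bridgeless G \<and>
     C \<subseteq> faces G \<and> C \<noteq> {} \<and> connected_faces G C \<and> disk_region G C"


section \<open>Replacing a configuration\<close>

text \<open>The cyclic order in which the spokes leave the region, counterclockwise seen from
  inside: walk along the boundary of the region, with the exterior on the right hand
  side, treating the inner ends of the spokes as dead ends.\<close>

definition boundary_walk :: "'a ribbon_graph \<Rightarrow> ('a \<times> bool) set set \<Rightarrow> 'a \<Rightarrow> 'a" where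
  "boundary_walk G C d = rot G (if d \<in> spokes G C then d else opp G d)"

definition next_spoke :: "'a ribbon_graph \<Rightarrow> ('a \<times> bool) set set \<Rightarrow> 'a \<Rightarrow> 'a" where
  "next_spoke G C s =
     (boundary_walk G C ^^ (LEAST n. 0 < n \<and> (boundary_walk G C ^^ n) s \<in> spokes G C)) s"

text \<open>
  A plane trivalent piece of graph \<open>P\<close> in a disk with the crossing points of \<open>C\<close> on its
  boundary is given as the plane graph that arises when the complement of the disk is
  shrunk to one extra vertex.  The darts at the extra vertex are the crossing points; on
  the sphere they appear there counterclockwise in the reverse of their order around the
  disk.  Two crossing points may be joined by an edge of \<open>P\<close>: this is an arc through the
  disk without vertices.  All other darts of \<open>P\<close> are new.  Connectedness of \<open>P\<close> is no
  restriction: a component of \<open>P\<close> avoiding the extra vertex would be a component of the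
  graph obtained by the replacement.
\<close>

definition disk_piece ::
    "'a ribbon_graph \<Rightarrow> ('a \<times> bool) set set \<Rightarrow> 'a ribbon_graph \<Rightarrow> bool" where
  "disk_piece G C P \<longleftrightarrow>
     plane_graph P \<and> darts P \<inter> darts G = spokes G C \<and>
     (\<forall>s\<in>spokes G C. rot P (next_spoke G C s) = s) \<and>
     (\<forall>d\<in>darts P - spokes G C. card (orbit (rot P) d) = 3)"

text \<open>Arcs of the exterior of the region in \<open>G\<close> and arcs of the piece \<open>P\<close>; both kinds end
  in darts or in crossing points.\<close>

definition gluing :: "'a ribbon_graph \<Rightarrow> ('a \<times> bool) set set \<Rightarrow> 'a ribbon_graph \<Rightarrow> ('a \<times> 'a) set" where
  "gluing G C P =
     {(x, opp G x) | x. x \<in> outer_darts G C \<union> spokes G C} \<union> {(x, opp P x) | x. x \<in> darts P}"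

text \<open>
  \<open>G'\<close> arises from \<open>G\<close> by replacing \<open>C\<close> with \<open>P\<close>.  An edge of \<open>G'\<close> is a maximal chain of
  arcs glued at crossing points, so a dart is opposite to the only other dart of \<open>G'\<close> on
  its chain.  The last condition excludes closed curves without vertices.  The edges
  outside the configurations are literally the same sets of darts in \<open>G\<close> and \<open>G'\<close>.
\<close>

definition replacement ::
    "'a ribbon_graph \<Rightarrow> ('a \<times> bool) set set \<Rightarrow> 'a ribbon_graph \<Rightarrow> 'a ribbon_graph \<Rightarrow> bool" where
  "replacement G C P G' \<longleftrightarrow>
     disk_piece G C P \<and>
     plane_graph G' \<and> trivalent G' \<and>
     darts G' = outer_darts G C \<union> (darts P - spokes G C) \<and>
     (\<forall>d\<in>outer_darts G C. rot G' d = rot G d) \<and>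
     (\<forall>d\<in>darts P - spokes G C. rot G' d = rot P d) \<and>
     (\<forall>d\<in>darts G'. (d, opp G' d) \<in> (gluing G C P)\<^sup>*) \<and>
     (\<forall>s\<in>spokes G C. \<exists>d\<in>darts G'. (d, s) \<in> (gluing G C P)\<^sup>*)"

definition is_reducer ::
    "'a ribbon_graph \<Rightarrow> ('a \<times> bool) set set \<Rightarrow> 'a ribbon_graph \<Rightarrow> 'a ribbon_graph \<Rightarrow> bool" where
  "is_reducer G C P G' \<longleftrightarrow>
     configuration G C \<and> replacement G C P G' \<and>
     card (vertices G') + card (edges G') < card (vertices G) + card (edges G)"


section \<open>State-reducibility\<close>

text \<open>The argument is an enhanced state of \<open>G'\<close>.  Agreement outside the configurations
  concerns the twists only.\<close>

definition state_extendible ::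
    "'a ribbon_graph \<Rightarrow> ('a \<times> bool) set set \<Rightarrow>
     'a set set \<times> (('a \<times> bool) set \<Rightarrow> nat) \<Rightarrow> bool" where
  "state_extendible G C S' \<longleftrightarrow>
     (\<exists>S\<in>enhanced_states 4 G. fst S \<inter> outside_edges G C = fst S' \<inter> outside_edges G C)"

definition state_reducible ::
    "'a ribbon_graph \<Rightarrow> ('a \<times> bool) set set \<Rightarrow> 'a ribbon_graph \<Rightarrow> 'a ribbon_graph \<Rightarrow> bool" where
  "state_reducible G C P G' \<longleftrightarrow>
     is_reducer G C P G' \<and> enhanced_states 3 G' \<noteq> {} \<and>
     (\<forall>S'\<in>enhanced_states 3 G'. state_extendible G C S')"

end

theory Submission
  imports Defs
begin

text \<open>
  Read the four colors as the elements of \<open>\<int>/2 \<times> \<int>/2\<close>.  For a face coloring of a state graph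
  of \<open>G\<close>, give every edge the sum of the colors on its two sides.  This labelling is nowhere
  zero exactly because the coloring is proper.  The labels around a vertex sum to zero,
  since the face on the left of a dart is the face on the right of the next dart.  Both
  properties refer to the graph and its rotation system only: the half-twists have
  disappeared.  (At a trivalent vertex the three labels are distinct, so this is a Tait
  coloring of the edges.)

  Thus each of the two bits of the labelling is a cycle modulo 2 of the 1-skeleton of \<open>G\<close>
  (\<open>side_cut_in_cycle_space\<close>).  On the sphere every such cycle separates a set of faces from
  its complement (\<open>cycle_is_face_cut\<close>).  The two sets of faces obtained in this way are the
  two bits of a new color for each face of \<open>G\<close> itself, and the faces on the two sides of an
  edge differ in a bit for which the label of the edge is nonzero.  So one 4-face colorable
  state graph suffices to make \<open>G\<close> 4-face colorable
  (\<open>face_colorable_4_if_state_graph_face_colorable_4\<close>).  State-reducibility provides one: some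
  state graph of the reducer has a 3-face coloring, and it extends to an enhanced state of
  \<open>G\<close> with four colors.

  That cycles on the sphere are cuts follows from Euler's formula by counting.  With \<open>V\<close>
  vertices, \<open>E\<close> edges and \<open>F\<close> faces, connectedness bounds the number of cycles by
  \<open>2\<^sup>E / 2\<^sup>V\<^sup>-\<^sup>1\<close> and makes the cuts of the \<open>2\<^sup>F\<^sup>-\<^sup>1\<close> sets of faces avoiding a fixed face pairwise
  different.  As every cut is a cycle and \<open>E - (V - 1) = F - 1\<close>, all cycles are cuts.
\<close>

section \<open>Vertices and edges\<close>

lemma permutation_rot: "ribbon_graph R \<Longrightarrow> permutation (rot R)"
  by (auto simp: ribbon_graph_def permutation_permutes)

lemma vertex_eq_orbit:
  assumes "ribbon_graph R" "v \<in> vertices R" "d \<in> v"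
  shows "v = orbit (rot R) d"
  using assms orbit_cyclic_eq3[OF cyclic_on_orbit'[OF permutation_rot[OF assms(1)]]]
  by (auto simp: vertices_def)

lemma dart_in_orbit: "ribbon_graph R \<Longrightarrow> d \<in> orbit (rot R) d"
  by (simp add: permutation_rot permutation_self_in_orbit)

lemma vertex_rot_iff:
  assumes "ribbon_graph R" "v \<in> vertices R"
  shows "rot R d \<in> v \<longleftrightarrow> d \<in> v"
proof
  assume "d \<in> v"
  then show "rot R d \<in> v"
    using assms by (auto simp: vertices_def intro: orbit.step)
next
  assume "rot R d \<in> v"
  then have "v = orbit (rot R) d"
    using vertex_eq_orbit[OF assms] permutation_orbit_step[OF permutation_rot[OF assms(1)]]
    by metis
  then show "d \<in> v" using dart_in_orbit[OF assms(1)] by simp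
qed

lemma vertex_subset_darts:
  assumes "ribbon_graph R" "v \<in> vertices R"
  shows "v \<subseteq> darts R"
proof -
  obtain a where "a \<in> darts R" "v = orbit (rot R) a"
    using assms(2) by (auto simp: vertices_def)
  then show ?thesis
    using assms(1) by (auto simp: ribbon_graph_def dest: permutes_orbit_subset)
qed

lemma finite_vertex: "ribbon_graph R \<Longrightarrow> v \<in> vertices R \<Longrightarrow> finite v"
  by (meson finite_subset ribbon_graph_def vertex_subset_darts)

lemma edge_eq_iff:
  assumes "ribbon_graph R" "d \<in> darts R" "a \<in> darts R"
  shows "{a, opp R a} = {d, opp R d} \<longleftrightarrow> a = d \<or> a = opp R d"
  using assms unfolding ribbon_graph_def by (metis doubleton_eq_iff)


section \<open>The cycle space modulo 2\<close>

text \<open>Darts are counted rather than edges, so a loop contributes two to the degree of its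
  vertex and leaves the parity unchanged.\<close>

definition odd_at :: "'a ribbon_graph \<Rightarrow> 'a set set \<Rightarrow> 'a set \<Rightarrow> bool" where
  "odd_at R X v \<longleftrightarrow> odd (card {d \<in> v. {d, opp R d} \<in> X})"

definition cycle_space :: "'a ribbon_graph \<Rightarrow> 'a set set set" where
  "cycle_space R = {X. X \<subseteq> edges R \<and> (\<forall>v\<in>vertices R. \<not> odd_at R X v)}"

lemma odd_card_sym_diff:
  assumes "finite A" "finite B"
  shows "odd (card (sym_diff A B)) \<longleftrightarrow> odd (card A) \<noteq> odd (card B)"
proof -
  have "card (sym_diff A B) = card (A - B) + card (B - A)"
    using assms by (intro card_Un_disjoint) auto
  moreover have "card A = card (A - B) + card (A \<inter> B)" 
    using assms by (metis card_Diff_subset_Int card_mono finite_Int inf_le1 le_add_diff_inverse2)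
  moreover have "card B = card (B - A) + card (A \<inter> B)" 
    using assms by (metis card_Diff_subset_Int card_mono finite_Int inf_le1 inf_commute le_add_diff_inverse2)
  ultimately show ?thesis by auto
qed

lemma odd_at_sym_diff:
  assumes "ribbon_graph R" "v \<in> vertices R"
  shows "odd_at R (sym_diff X Y) v \<longleftrightarrow> odd_at R X v \<noteq> odd_at R Y v"
proof -
  have "{d \<in> v. {d, opp R d} \<in> sym_diff X Y}
      = sym_diff {d \<in> v. {d, opp R d} \<in> X} {d \<in> v. {d, opp R d} \<in> Y}"
    by auto
  then show ?thesis
    using finite_vertex[OF assms] by (simp add: odd_at_def odd_card_sym_diff)
qed

lemma odd_at_edge:
  assumes "ribbon_graph R" "v \<in> vertices R" "d \<in> darts R"
  shows "odd_at R {{d, opp R d}} v \<longleftrightarrow> (d \<in> v) \<noteq> (opp R d \<in> v)"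
proof -
  have "{a \<in> v. {a, opp R a} \<in> {{d, opp R d}}} = v \<inter> {d, opp R d}"
    using edge_eq_iff[OF assms(1,3)] vertex_subset_darts[OF assms(1,2)]
      assms unfolding ribbon_graph_def by auto
  moreover have "opp R d \<noteq> d"
    using assms by (auto simp: ribbon_graph_def)
  ultimately show ?thesis
    by (auto simp: odd_at_def Int_insert_right)
qed

text \<open>Add up modulo 2 the edges of a walk from \<open>r\<close> to \<open>x\<close>: a step along \<open>rot\<close> stays at the
  vertex, and a step along \<open>opp\<close> changes the parities at the two ends of its edge.\<close>

lemma path_with_given_ends:
  assumes R: "ribbon_graph R" and "connected_graph R" "r \<in> darts R" "x \<in> darts R"
  shows "\<exists>X\<subseteq>edges R. \<forall>v\<in>vertices R. odd_at R X v \<longleftrightarrow> (r \<in> v) \<noteq> (x \<in> v)"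
proof -
  let ?E = "{(d, rot R d) | d. d \<in> darts R} \<union>
            {(d, opp R d) | d. d \<in> darts R \<and> {d, opp R d} \<in> edges R}"
  have "(r, x) \<in> ?E\<^sup>*"
    using assms unfolding connected_graph_def connected_via_def by blast
  then show ?thesis
  proof (induction rule: rtrancl_induct)
    case base
    then show ?case by (intro exI[of _ "{}"]) (auto simp: odd_at_def)
  next
    case (step y z)
    then obtain X where X: "X \<subseteq> edges R"
      "\<forall>v\<in>vertices R. odd_at R X v \<longleftrightarrow> (r \<in> v) \<noteq> (y \<in> v)" by blast
    from step.hyps(2) consider "z = rot R y"
      | "y \<in> darts R" "z = opp R y" "{y, opp R y} \<in> edges R" by blast
    then show ?case
    proof cases
      case 1
      then show ?thesis using X vertex_rot_iff[OF R] by blast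
    next
      case 2
      let ?Y = "sym_diff X {{y, opp R y}}"
      have "?Y \<subseteq> edges R" using X 2 by auto
      moreover have "\<forall>v\<in>vertices R. odd_at R ?Y v \<longleftrightarrow> (r \<in> v) \<noteq> (z \<in> v)"
        using X(2) 2(2) by (auto simp: odd_at_sym_diff[OF R] odd_at_edge[OF R _ 2(1)])
      ultimately show ?thesis by blast
    qed
  qed
qed

text \<open>The sum modulo 2 of paths from the vertex of \<open>r\<close> to all vertices in \<open>S\<close>.  The parity at
  the vertex of \<open>r\<close> is forced by the others, hence that vertex is left out.\<close>

lemma edge_set_with_given_parities:
  assumes R: "ribbon_graph R" and con: "connected_graph R" and r: "r \<in> darts R"
    and "S \<subseteq> vertices R - {orbit (rot R) r}"
  shows "\<exists>X\<subseteq>edges R. \<forall>v\<in>vertices R - {orbit (rot R) r}. odd_at R X v \<longleftrightarrow> v \<in> S"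
proof -
  have "finite S"
    using assms by (auto simp: ribbon_graph_def vertices_def elim!: finite_subset)
  then show ?thesis using assms(4)
  proof (induction rule: finite_induct)
    case empty
    show ?case by (intro exI[of _ "{}"]) (auto simp: odd_at_def)
  next
    case (insert w S)
    then obtain X where X: "X \<subseteq> edges R"
      "\<forall>v\<in>vertices R - {orbit (rot R) r}. odd_at R X v \<longleftrightarrow> v \<in> S" by auto
    obtain x where x: "x \<in> darts R" "w = orbit (rot R) x"
      using insert.prems by (auto simp: vertices_def)
    obtain Y where Y: "Y \<subseteq> edges R"
      "\<forall>v\<in>vertices R. odd_at R Y v \<longleftrightarrow> (r \<in> v) \<noteq> (x \<in> v)"
      using path_with_given_ends[OF R con r x(1)] by blast
    have "odd_at R (sym_diff X Y) v \<longleftrightarrow> v \<in> insert w S"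
      if v: "v \<in> vertices R - {orbit (rot R) r}" for v
    proof -
      have "r \<notin> v" using v vertex_eq_orbit[OF R] by blast
      moreover have "x \<in> v \<longleftrightarrow> v = w"
        using v vertex_eq_orbit[OF R] dart_in_orbit[OF R] x by blast
      ultimately show ?thesis
        using X(2) Y(2) v odd_at_sym_diff[OF R] insert.hyps(2) by auto
    qed
    moreover have "sym_diff X Y \<subseteq> edges R" using X Y by auto
    ultimately show ?case by blast
  qed
qed

text \<open>The boundary map from edge sets to sets of vertices of odd degree has an image of at
  least \<open>2 ^ (V - 1)\<close> elements, and each of its fibres is a translate of the cycle space.
  Choosing one edge set \<open>X S\<close> for each set \<open>S\<close> of vertices other than a fixed one, the sums
  of \<open>X S\<close> and a cycle are pairwise different: \<open>S\<close> can be read off from the odd vertices.\<close>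

lemma card_cycle_space_le:
  assumes R: "ribbon_graph R" and con: "connected_graph R" and ne: "darts R \<noteq> {}"
  shows "card (cycle_space R) * 2 ^ (card (vertices R) - 1) \<le> 2 ^ card (edges R)"
proof -
  obtain r where r: "r \<in> darts R" using ne by blast
  let ?V = "vertices R - {orbit (rot R) r}"
  have fin: "finite (vertices R)" "finite (edges R)"
    using R by (auto simp: ribbon_graph_def vertices_def edges_def)
  have "\<exists>X. \<forall>S\<in>Pow ?V. X S \<subseteq> edges R \<and> (\<forall>v\<in>?V. odd_at R (X S) v \<longleftrightarrow> v \<in> S)"
    using edge_set_with_given_parities[OF R con r] by (intro bchoice) auto
  then obtain X where X: "\<And>S. S \<subseteq> ?V \<Longrightarrow> X S \<subseteq> edges R"
    "\<And>S v. S \<subseteq> ?V \<Longrightarrow> v \<in> ?V \<Longrightarrow> odd_at R (X S) v \<longleftrightarrow> v \<in> S"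
    by (meson PowI)
  let ?f = "\<lambda>(Z, S). sym_diff Z (X S)"
  have "inj_on ?f (cycle_space R \<times> Pow ?V)"
  proof (rule inj_onI, clarify)
    fix Z S Z' S'
    assume Z: "Z \<in> cycle_space R" "Z' \<in> cycle_space R" and S: "S \<subseteq> ?V" "S' \<subseteq> ?V"
      and eq: "sym_diff Z (X S) = sym_diff Z' (X S')"
    have parity: "odd_at R (sym_diff Y (X T)) v \<longleftrightarrow> v \<in> T"
      if "Y \<in> cycle_space R" "T \<subseteq> ?V" "v \<in> ?V" for Y T v
      using that X(2) odd_at_sym_diff[OF R] by (auto simp: cycle_space_def)
    have "v \<in> S \<longleftrightarrow> v \<in> S'" if "v \<in> ?V" for v
      using parity[OF Z(1) S(1) that] parity[OF Z(2) S(2) that] eq by simp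
    then have "S = S'" using S by blast
    with eq show "Z = Z' \<and> S = S'" by blast
  qed
  moreover have "?f ` (cycle_space R \<times> Pow ?V) \<subseteq> Pow (edges R)"
    using X(1) by (auto simp: cycle_space_def)
  ultimately have "card (cycle_space R \<times> Pow ?V) \<le> card (Pow (edges R))"
    using fin by (intro card_inj_on_le[of ?f]) auto
  moreover have "orbit (rot R) r \<in> vertices R" using r by (auto simp: vertices_def)
  ultimately show ?thesis using fin by (simp add: card_cartesian_product card_Pow)
qed


section \<open>Cuts between the two sides of the edges\<close>

text \<open>For a set of faces, given by the predicate \<open>p\<close> on flags, its boundary modulo 2 in the
  sense of cellular homology: an edge with the same face on both sides is not included.\<close>

definition side_cut :: "'a ribbon_graph \<Rightarrow> ('a \<times> bool \<Rightarrow> bool) \<Rightarrow> 'a set set" where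
  "side_cut R p = {{d, opp R d} | d. d \<in> darts R \<and> p (d, True) \<noteq> p (d, False)}"

definition constant_on_faces :: "'a ribbon_graph \<Rightarrow> ('a \<times> bool \<Rightarrow> bool) \<Rightarrow> bool" where
  "constant_on_faces R p \<longleftrightarrow> (\<forall>(x, y)\<in>boundary_step R. p x = p y)"

lemma face_of_eq:
  assumes "(x, y) \<in> boundary_step R"
  shows "face_of R x = face_of R y"
proof -
  have "equiv UNIV (boundary_rel R)"
    unfolding boundary_rel_def
    by (intro equivI) (auto intro: refl_rtrancl trans_rtrancl sym_rtrancl simp: sym_Un_converse)
  moreover have "(x, y) \<in> boundary_rel R"
    using assms by (auto simp: boundary_rel_def)
  ultimately show ?thesis
    unfolding face_of_def by (simp add: equiv_class_eq)
qed

lemma constant_on_faces_face_of: "constant_on_faces R (\<lambda>x. q (face_of R x))"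
  using face_of_eq by (fastforce simp: constant_on_faces_def)

lemma constant_on_faces_rot:
  "constant_on_faces R p \<Longrightarrow> d \<in> darts R \<Longrightarrow> p (rot R d, False) = p (d, True)"
  unfolding constant_on_faces_def boundary_step_def by blast

lemma constant_on_faces_opp:
  "constant_on_faces R p \<Longrightarrow> d \<in> darts R \<Longrightarrow>
   p (opp R d, if {d, opp R d} \<in> twisted R then s else \<not> s) = p (d, s)"
  unfolding constant_on_faces_def boundary_step_def by blast

lemma edge_in_side_cut_iff:
  assumes R: "ribbon_graph R" and p: "constant_on_faces R p" and d: "d \<in> darts R"
  shows "{d, opp R d} \<in> side_cut R p \<longleftrightarrow> p (d, True) \<noteq> p (d, False)"
proof
  assume "{d, opp R d} \<in> side_cut R p"
  then obtain a where a: "a \<in> darts R" "{d, opp R d} = {a, opp R a}"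
    "p (a, True) \<noteq> p (a, False)"
    by (auto simp: side_cut_def)
  then have "d = a \<or> d = opp R a" using edge_eq_iff[OF R] d by blast
  then show "p (d, True) \<noteq> p (d, False)"
    using a(3) constant_on_faces_opp[OF p a(1), of True] constant_on_faces_opp[OF p a(1), of False]
    by (auto split: if_splits)
qed (use d in \<open>auto simp: side_cut_def\<close>)

text \<open>The boundary of a boundary vanishes.  At a vertex \<open>v\<close>, the degree in the cut has the
  parity of the number of flags at \<open>v\<close> with \<open>p\<close>, and rotation matches the left flags with \<open>p\<close>
  to the right flags with \<open>p\<close>.  A half-twist
  only swaps the two sides of an edge as seen from its other end, which does not affect
  whether they differ.\<close>

lemma side_cut_in_cycle_space:
  assumes R: "ribbon_graph R" and p: "constant_on_faces R p"
  shows "side_cut R p \<in> cycle_space R"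
proof -
  have "\<not> odd_at R (side_cut R p) v" if v: "v \<in> vertices R" for v
  proof -
    let ?T = "{d \<in> v. p (d, True)}" and ?F = "{d \<in> v. p (d, False)}"
    have sub: "v \<subseteq> darts R" by (rule vertex_subset_darts[OF R v])
    have bij: "bij (rot R)" using R by (auto simp: ribbon_graph_def permutes_bij)
    have "rot R ` ?T = ?F"
    proof (intro equalityI subsetI)
      fix d assume "d \<in> ?F"
      moreover obtain a where "d = rot R a" using bij by (metis bij_pointE)
      ultimately show "d \<in> rot R ` ?T"
        using vertex_rot_iff[OF R v] constant_on_faces_rot[OF p] sub by blast
    qed (use vertex_rot_iff[OF R v] constant_on_faces_rot[OF p] sub in blast)
    moreover have "inj_on (rot R) ?T"
      using bij by (meson bij_is_inj inj_on_subset subset_UNIV)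
    ultimately have "card ?T = card ?F" by (metis (no_types) card_image)
    moreover have "{d \<in> v. {d, opp R d} \<in> side_cut R p} = sym_diff ?T ?F"
      using edge_in_side_cut_iff[OF R p] sub by blast
    ultimately show ?thesis
      using finite_vertex[OF R v] by (simp add: odd_at_def odd_card_sym_diff)
  qed
  moreover have "side_cut R p \<subseteq> edges R" by (auto simp: side_cut_def edges_def)
  ultimately show ?thesis by (simp add: cycle_space_def)
qed

text \<open>The dual graph is connected because the graph is: adjacent darts at a vertex share a
  face, and so do the two halves of an edge.\<close>

lemma constant_if_no_side_cut:
  assumes R: "ribbon_graph R" and con: "connected_graph R"
    and p: "constant_on_faces R p"
    and sides: "\<And>d. d \<in> darts R \<Longrightarrow> p (d, True) = p (d, False)"
    and "r \<in> darts R" "x \<in> darts R"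
  shows "p (x, s) = p (r, t)"
proof -
  let ?E = "{(d, rot R d) | d. d \<in> darts R} \<union>
            {(d, opp R d) | d. d \<in> darts R \<and> {d, opp R d} \<in> edges R}"
  have "(r, x) \<in> ?E\<^sup>*"
    using con assms(5,6) unfolding connected_graph_def connected_via_def by blast
  then have "x \<in> darts R \<and> p (x, True) = p (r, True)"
  proof (induction rule: rtrancl_induct)
    case (step y z)
    have "rot R y \<in> darts R \<and> opp R y \<in> darts R"
      using R step.IH unfolding ribbon_graph_def by (metis permutes_in_image)
    then show ?case
      using step sides[of y] sides[of z] constant_on_faces_rot[OF p, of y]
        constant_on_faces_opp[OF p, of y True] by (auto split: if_splits)
  qed (use assms in simp)
  then show ?thesis using sides[of x] sides[of r] assms(5) by (cases s; cases t) auto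
qed


section \<open>Cuts and cycles on the sphere\<close>

text \<open>The first homology of the sphere modulo 2 vanishes.  Two sets of faces with the same
  cut differ by none or by all of the faces, so fixing one face \<open>?f\<close> to lie outside makes
  the cut injective; then Euler's formula equates the number of cuts with the upper bound
  on the number of cycles.\<close>

lemma cycle_is_face_cut:
  assumes G: "plane_graph G" and Z: "Z \<in> cycle_space G"
  shows "\<exists>S. Z = side_cut G (\<lambda>x. face_of G x \<in> S)"
proof -
  have R: "ribbon_graph G" and con: "connected_graph G"
    and euler: "int (card (vertices G)) - int (card (edges G)) + int (card (faces G)) = 2"
    using G by (auto simp: plane_graph_def)
  have fin: "finite (vertices G)" "finite (edges G)" "finite (faces G)"
    using R by (auto simp: ribbon_graph_def vertices_def edges_def faces_def flags_def quotient_def)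
  have ne: "darts G \<noteq> {}"
    using euler by (auto simp: vertices_def edges_def faces_def flags_def)
  then obtain r where r: "r \<in> darts G" by blast
  have face: "face_of G (d, s) \<in> faces G" if "d \<in> darts G" for d s
    using that by (auto simp: face_of_def faces_def flags_def intro: quotientI)
  let ?f = "face_of G (r, True)"
  let ?cut = "\<lambda>S. side_cut G (\<lambda>x. face_of G x \<in> S)"
  let ?F = "Pow (faces G - {?f})"
  have "inj_on ?cut ?F"
  proof (rule inj_onI)
    fix S T assume S: "S \<in> ?F" and T: "T \<in> ?F" and eq: "?cut S = ?cut T"
    let ?p = "\<lambda>x. (face_of G x \<in> S) \<noteq> (face_of G x \<in> T)"
    have same: "?p (d, True) = ?p (d, False)" if "d \<in> darts G" for d
      using edge_in_side_cut_iff[OF R constant_on_faces_face_of that, of "\<lambda>f. f \<in> S"]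
        edge_in_side_cut_iff[OF R constant_on_faces_face_of that, of "\<lambda>f. f \<in> T"] eq by auto
    have "\<not> ?p (d, s)" if "d \<in> darts G" for d s
      using constant_if_no_side_cut[OF R con
          constant_on_faces_face_of[of G "\<lambda>f. (f \<in> S) \<noteq> (f \<in> T)"] same r that, of s True]
        S T by auto
    moreover have "\<exists>d\<in>darts G. \<exists>s. f = face_of G (d, s)" if "f \<in> faces G" for f
      using that by (auto simp: faces_def face_of_def flags_def elim!: quotientE)
    ultimately show "S = T" using S T by blast
  qed
  then have "card (?cut ` ?F) = 2 ^ (card (faces G) - 1)"
    using face[OF r] fin by (simp add: card_image card_Pow)
  moreover have "card (cycle_space G) \<le> 2 ^ (card (faces G) - 1)"
  proof -
    have "orbit (rot G) r \<in> vertices G" "?f \<in> faces G"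
      using r face by (auto simp: vertices_def)
    then have "card (vertices G) > 0" "card (faces G) > 0"
      using fin card_gt_0_iff by blast+
    then have "card (edges G) = (card (faces G) - 1) + (card (vertices G) - 1)"
      using euler by linarith
    with card_cycle_space_le[OF R con ne] show ?thesis by (simp add: power_add)
  qed
  moreover have "?cut ` ?F \<subseteq> cycle_space G"
    using side_cut_in_cycle_space[OF R constant_on_faces_face_of[of G "\<lambda>f. f \<in> S" for S]] by auto
  moreover have "finite (cycle_space G)"
    using fin by (auto simp: cycle_space_def)
  ultimately have "?cut ` ?F = cycle_space G"
    by (metis card_seteq)
  then show ?thesis using Z by blast
qed

lemma cycle_space_state_graph: "cycle_space (state_graph G A) = cycle_space G"
  by (simp add: cycle_space_def odd_at_def edges_def vertices_def state_graph_def)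

lemma side_cut_state_graph: "side_cut (state_graph G A) p = side_cut G p"
  by (simp add: side_cut_def state_graph_def)

text \<open>A coloring of the state graph is moved to \<open>G\<close> one bit at a time.  The faces of the two
  surfaces have no correspondence; what is kept is, for each edge, whether the bit differs
  on its two sides.\<close>

lemma face_colorable_4_if_state_graph_face_colorable_4:
  assumes G: "plane_graph G" and A: "A \<subseteq> edges G"
    and "face_colorable 4 (state_graph G A)"
  shows "face_colorable 4 G"
proof -
  let ?H = "state_graph G A"
  obtain c where c: "face_coloring 4 ?H c"
    using assms(3) by (auto simp: face_colorable_def)
  have R: "ribbon_graph G" using G by (simp add: plane_graph_def)
  have H: "ribbon_graph ?H"
    using R A by (simp add: ribbon_graph_def state_graph_def edges_def)
  have [simp]: "darts ?H = darts G" "opp ?H = opp G" by (simp_all add: state_graph_def)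
  have transfer: "\<exists>S. \<forall>d\<in>darts G. (q (face_of ?H (d, True)) \<noteq> q (face_of ?H (d, False)))
      \<longleftrightarrow> (face_of G (d, True) \<in> S) \<noteq> (face_of G (d, False) \<in> S)"
    for q :: "('a \<times> bool) set \<Rightarrow> bool"
  proof -
    have "side_cut G (\<lambda>x. q (face_of ?H x)) \<in> cycle_space G"
      using side_cut_in_cycle_space[OF H constant_on_faces_face_of[of ?H q]]
      by (simp add: cycle_space_state_graph side_cut_state_graph)
    from cycle_is_face_cut[OF G this] obtain S where
      S: "side_cut G (\<lambda>x. q (face_of ?H x)) = side_cut G (\<lambda>x. face_of G x \<in> S)"
      by (rule exE)
    have "(q (face_of ?H (d, True)) \<noteq> q (face_of ?H (d, False)))
        \<longleftrightarrow> (face_of G (d, True) \<in> S) \<noteq> (face_of G (d, False) \<in> S)"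
      if d: "d \<in> darts G" for d
      using edge_in_side_cut_iff[OF H constant_on_faces_face_of[of ?H q], of d]
        edge_in_side_cut_iff[OF R constant_on_faces_face_of[of G "\<lambda>f. f \<in> S"] d] d S
      by (simp add: side_cut_state_graph)
    then show ?thesis by blast
  qed
  \<comment> \<open>The two bits of a color below 4 are its parity and whether it is at least 2.\<close>
  obtain S where S: "\<forall>d\<in>darts G.
      (odd (c (face_of ?H (d, True))) \<noteq> odd (c (face_of ?H (d, False))))
      \<longleftrightarrow> (face_of G (d, True) \<in> S) \<noteq> (face_of G (d, False) \<in> S)"
    using transfer[of "\<lambda>f. odd (c f)"] by (rule exE)
  obtain T where T: "\<forall>d\<in>darts G.
      ((2 \<le> c (face_of ?H (d, True))) \<noteq> (2 \<le> c (face_of ?H (d, False))))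
      \<longleftrightarrow> (face_of G (d, True) \<in> T) \<noteq> (face_of G (d, False) \<in> T)"
    using transfer[of "\<lambda>f. 2 \<le> c f"] by (rule exE)
  define c' :: "_ \<Rightarrow> nat" where "c' f = of_bool (f \<in> S) + 2 * of_bool (f \<in> T)" for f
  have bits: "a = b" if "a < 4" "b < 4" "odd a = odd b" "(2 \<le> a) = (2 \<le> b)" for a b :: nat
    using that by presburger
  have "c' (face_of G (d, True)) \<noteq> c' (face_of G (d, False))" if d: "d \<in> darts G" for d
  proof -
    have "face_of ?H (d, s) \<in> faces ?H" for s
      using d by (auto simp: face_of_def faces_def flags_def intro: quotientI)
    then have "c (face_of ?H (d, s)) < 4" for s
      using c by (simp add: face_coloring_def)
    moreover have "c (face_of ?H (d, True)) \<noteq> c (face_of ?H (d, False))"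
      using c d by (simp add: face_coloring_def)
    ultimately have "odd (c (face_of ?H (d, True))) \<noteq> odd (c (face_of ?H (d, False)))
        \<or> (2 \<le> c (face_of ?H (d, True))) \<noteq> (2 \<le> c (face_of ?H (d, False)))"
      using bits by blast
    then have "(face_of G (d, True) \<in> S) \<noteq> (face_of G (d, False) \<in> S)
        \<or> (face_of G (d, True) \<in> T) \<noteq> (face_of G (d, False) \<in> T)"
      using S T d by blast
    then show ?thesis by (auto simp: c'_def)
  qed
  then have "face_coloring 4 G c'"
    by (auto simp: face_coloring_def c'_def)
  then show ?thesis by (auto simp: face_colorable_def)
qed

theorem theorem1:
  fixes G C' G' :: "'a ribbon_graph"
    and C :: "('a \<times> bool) set set"
  assumes "plane_graph G" and "trivalent G"
    and "configuration G C"
    and "replacement G C C' G'"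
    and "state_reducible G C C' G'"
    and "face_colorable 4 G'"
  shows "face_colorable 4 G"
proof -
  obtain S' where "S' \<in> enhanced_states 3 G'" "state_extendible G C S'"
    using assms(5) by (auto simp: state_reducible_def)
  then obtain A c where "A \<subseteq> edges G" "face_coloring 4 (state_graph G A) c"
    by (auto simp: state_extendible_def enhanced_states_def)
  then show ?thesis
    using face_colorable_4_if_state_graph_face_colorable_4[OF assms(1)]
    by (auto simp: face_colorable_def)
qed

end
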